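(* The set of rational values $\rho$ carrying at least four distinct genuine pairs is dense in \[ \left[\frac{3239209}{6414409},\frac{85249}{150049}\right]. \]
   Context: A rational triangle is a triangle with rational side lengths (its area need not be rational). For $\rho\in\mathbb{Q}\cap(-1,1)$ let $\theta\in(0,\pi)$ be the angle with $\cos\theta=\rho$. A genuine pair for $\rho$ is a pair $(T,I)$ of non-degenerate rational triangles such that $T$ has an angle equal to $\theta$, $I$ is isosceles, $T$ and $I$ have the same perimeter and the same area, and $T$ and $I$ are not congruent. Genuine pairs are counted up to homothety: $(T,I)$ and $(T',I')$ are regarded as the same pair if there is a common scaling factor $\mu>0$ such that $T'$ is congruent to $\mu T$ and $I'$ is congruent to $\mu I$; otherwise they are distinct. A value $\rho$ carries at least four distinct genuine pairs if there are at least four distinct genuine pairs for $\rho$. *)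

theory Defs
  imports "HOL-Analysis.Analysis"
begin

text \<open>A triangle is given by its three vertices in the Euclidean plane; the order of the vertices
  carries no meaning, and every notion below is invariant under permuting them.\<close>

type_synonym triangle = "(real ^ 2) \<times> (real ^ 2) \<times> (real ^ 2)"

fun vertices :: "triangle \<Rightarrow> (real ^ 2) set" where
  "vertices (A, B, C) = {A, B, C}"

fun nondegenerate :: "triangle \<Rightarrow> bool" where
  "nondegenerate (A, B, C) \<longleftrightarrow> \<not> collinear {A, B, C}"

fun rational_sides :: "triangle \<Rightarrow> bool" where
  "rational_sides (A, B, C) \<longleftrightarrow> dist A B \<in> \<rat> \<and> dist B C \<in> \<rat> \<and> dist C A \<in> \<rat>"

definition rational_triangle :: "triangle \<Rightarrow> bool" where
  "rational_triangle T \<longleftrightarrow> nondegenerate T \<and> rational_sides T"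

fun perimeter :: "triangle \<Rightarrow> real" where
  "perimeter (A, B, C) = dist A B + dist B C + dist C A"

definition area :: "triangle \<Rightarrow> real" where
  "area T = measure lebesgue (convex hull (vertices T))"

definition angle_at :: "real ^ 2 \<Rightarrow> real ^ 2 \<Rightarrow> real ^ 2 \<Rightarrow> real" where
  "angle_at A B C = arccos (((B - A) \<bullet> (C - A)) / (norm (B - A) * norm (C - A)))"

fun has_angle :: "triangle \<Rightarrow> real \<Rightarrow> bool" where
  "has_angle (A, B, C) \<theta> \<longleftrightarrow>
     angle_at A B C = \<theta> \<or> angle_at B C A = \<theta> \<or> angle_at C A B = \<theta>"

fun isosceles :: "triangle \<Rightarrow> bool" where
  "isosceles (A, B, C) \<longleftrightarrow> dist A B = dist A C \<or> dist B A = dist B C \<or> dist C A = dist C B"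

definition congruent_triangles :: "triangle \<Rightarrow> triangle \<Rightarrow> bool" where
  "congruent_triangles T T' \<longleftrightarrow>
     (\<exists>f :: real ^ 2 \<Rightarrow> real ^ 2. (\<forall>x y. dist (f x) (f y) = dist x y) \<and> f ` vertices T = vertices T')"

fun scale_triangle :: "real \<Rightarrow> triangle \<Rightarrow> triangle" where
  "scale_triangle \<mu> (A, B, C) = (\<mu> *\<^sub>R A, \<mu> *\<^sub>R B, \<mu> *\<^sub>R C)"

text \<open>For \<open>-1 < \<rho> < 1\<close>, \<open>arccos \<rho>\<close> is the unique \<open>\<theta>\<close> in the open interval from \<open>0\<close> to \<open>pi\<close>
  with \<open>cos \<theta> = \<rho>\<close>.\<close>

definition genuine_pair :: "real \<Rightarrow> triangle \<times> triangle \<Rightarrow> bool" where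
  "genuine_pair \<rho> = (\<lambda>(T, I).
     rational_triangle T \<and> rational_triangle I \<and> has_angle T (arccos \<rho>) \<and> isosceles I \<and>
     perimeter T = perimeter I \<and> area T = area I \<and> \<not> congruent_triangles T I)"

definition same_pair :: "triangle \<times> triangle \<Rightarrow> triangle \<times> triangle \<Rightarrow> bool" where
  "same_pair = (\<lambda>(T, I) (T', I').
     \<exists>\<mu>>0. congruent_triangles T' (scale_triangle \<mu> T) \<and> congruent_triangles I' (scale_triangle \<mu> I))"

definition at_least_four_genuine_pairs :: "real \<Rightarrow> bool" where
  "at_least_four_genuine_pairs \<rho> \<longleftrightarrow>
     (\<exists>P. finite P \<and> card P = 4 \<and> (\<forall>p\<in>P. genuine_pair \<rho> p) \<and>
          pairwise (\<lambda>p q. \<not> same_pair p q) P)"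

end

theory Submission
  imports Defs
begin

text \<open>Normalise all perimeters to 2 and describe a triangle by its tangent lengths \<open>x, y, z\<close>, the
  distances from the vertices to the points of contact of the incircle: the sides are
  \<open>x + y\<close>, \<open>y + z\<close>, \<open>z + x\<close>, the semiperimeter is \<open>x + y + z = 1\<close>, and Heron's formula makes
  \<open>x y z\<close> the square of the area. If \<open>\<theta>\<close> is the angle at the vertex with tangent length \<open>x\<close> and
  \<open>\<tau> = tan (\<theta>/2)\<close>, then \<open>y z = \<tau>\<^sup>2 x\<close>, so the area is \<open>\<tau> x\<close>. An isosceles triangle with tangent
  lengths \<open>p, p, q\<close>, where \<open>q = \<sigma>\<^sup>2\<close> and \<open>p = (1 - \<sigma>\<^sup>2)/2\<close>, has area \<open>\<sigma> (1 - \<sigma>\<^sup>2)/2\<close>. A genuine pair is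
  therefore obtained from every rational solution of
  \[ x + y + z = 1, \qquad y z = \tau^2 x, \qquad \sigma (1 - \sigma^2) = 2 \tau x \]
  with distinct positive \<open>x, y, z\<close> and \<open>0 < \<sigma> < 1\<close>, and pairs with different \<open>\<sigma>\<close> are
  distinct (\<open>genuine_pair_of_partner_data\<close>, \<open>same_pair_imp_eq_parameter\<close>).

  For given \<open>\<tau>\<close> and \<open>x\<close> the last equation is a cubic in \<open>\<sigma>\<close> whose roots have sum 0. Hence if it has
  two positive rational roots, one triangle with angle \<open>\<theta>\<close> has two isosceles partners. There is a
  one-parameter family of \<open>\<tau>\<close> for which this happens at two values of \<open>x\<close>
  (\<open>four_genuine_pairs_family\<close>). Take rational \<open>a > b > 0\<close> with \<open>a\<^sup>2 + a b + b\<^sup>2 = 1\<close>; then \<open>a\<close> and \<open>b\<close>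
  are roots of the cubic for \<open>x = 1/3\<close> and \<open>\<tau> = 3 a b (a + b)/2\<close>. The discriminant identity
  \<open>4 N\<^sup>3 = ((a - b)(2 a + b)(a + 2 b))\<^sup>2 + 27 (a b (a + b))\<^sup>2\<close> for \<open>N = a\<^sup>2 + a b + b\<^sup>2\<close> shows that
  \<open>1 - 3 \<tau>\<^sup>2\<close> is the square of a rational \<open>\<delta>\<close>. This makes the other two tangent lengths
  \<open>(1 \<plusminus> \<delta>)/3\<close> rational, and it also yields a second triangle, with \<open>x = 4 \<tau>\<^sup>2 - 1\<close> and remaining
  tangent lengths \<open>1 - 2 \<tau>\<^sup>2 \<plusminus> \<delta>\<close>, whose cubic has the roots \<open>\<tau> \<plusminus> \<delta>\<close>.

  The conic \<open>a\<^sup>2 + a b + b\<^sup>2 = 1\<close> has a rational parametrisation by \<open>m\<close>, which turns \<open>\<rho> = cos \<theta>\<close> into a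
  continuous function of \<open>m\<close>. It takes the two end points of the interval at \<open>m = 5/2\<close> and
  \<open>m = 2\<close>, so by the intermediate value theorem and the density of rational \<open>m\<close> its
  values at rational points are dense in the interval.\<close>

section \<open>Triangles with prescribed tangent lengths\<close>

definition tangent_triangle :: "real \<Rightarrow> real \<Rightarrow> real \<Rightarrow> triangle" where
  "tangent_triangle x y z =
     (vector [0, 0], vector [x + y, 0],
      vector [(x * (x + y + z) - y * z) / (x + y), 2 * sqrt ((x + y + z) * x * y * z) / (x + y)])"

lemma dist_real2:
  fixes A B :: "real ^ 2"
  shows "dist A B = sqrt ((A $ 1 - B $ 1)\<^sup>2 + (A $ 2 - B $ 2)\<^sup>2)"
  by (simp add: dist_vec_def L2_set_def sum_2 dist_real_def)

text \<open>The third vertex is the intersection of two circles. Heron's formula gives its height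
  over the base, and both distance equations reduce to the identity
  \<open>(x s - y z)\<^sup>2 + 4 s x y z = (x s + y z)\<^sup>2\<close> with \<open>x s + y z = (x + y)(x + z)\<close> for \<open>s = x + y + z\<close>, or the
  one with \<open>x\<close> and \<open>y\<close> exchanged.\<close>

lemma tangent_triangle_cases:
  assumes "x > 0" "y > 0" "z > 0"
  obtains A B C where "tangent_triangle x y z = (A, B, C)"
    "dist A B = x + y" "dist B C = y + z" "dist C A = z + x"
proof -
  define s where "s = x + y + z"
  define u where "u = (x * s - y * z) / (x + y)"
  define h where "h = 2 * sqrt (s * x * y * z) / (x + y)"
  have xy: "x + y \<noteq> 0" using assms by simp
  have h2: "h\<^sup>2 = 4 * (s * x * y * z) / (x + y)\<^sup>2"
    using assms by (simp add: h_def s_def power_divide power_mult_distrib)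
  have u': "x + y - u = (y * s - x * z) / (x + y)"
    using xy by (simp add: u_def s_def field_simps)
  have "(x * s - y * z)\<^sup>2 + 4 * (s * x * y * z) = ((z + x) * (x + y))\<^sup>2"
    by (simp add: s_def power2_eq_square algebra_simps)
  then have CA: "u\<^sup>2 + h\<^sup>2 = (z + x)\<^sup>2"
    using xy by (simp add: h2 u_def power_divide power_mult_distrib flip: add_divide_distrib)
  have "(y * s - x * z)\<^sup>2 + 4 * (s * x * y * z) = ((y + z) * (x + y))\<^sup>2"
    by (simp add: s_def power2_eq_square algebra_simps)
  then have BC: "(x + y - u)\<^sup>2 + h\<^sup>2 = (y + z)\<^sup>2"
    unfolding u' using xy by (simp add: h2 power_divide power_mult_distrib flip: add_divide_distrib)
  show thesis
  proof (rule that)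
    show "tangent_triangle x y z = (vector [0, 0], vector [x + y, 0], vector [u, h])"
      by (simp add: tangent_triangle_def u_def h_def s_def)
    show "dist (vector [0, 0] :: real ^ 2) (vector [x + y, 0]) = x + y"
      using assms by (simp add: dist_real2)
    show "dist (vector [x + y, 0] :: real ^ 2) (vector [u, h]) = y + z"
      using assms BC by (simp add: dist_real2)
    show "dist (vector [u, h] :: real ^ 2) (vector [0, 0]) = z + x"
      using assms CA by (simp add: dist_real2)
  qed
qed

lemma rational_tangent_triangle:
  assumes "x > 0" "y > 0" "z > 0" "x \<in> \<rat>" "y \<in> \<rat>" "z \<in> \<rat>"
  shows "rational_triangle (tangent_triangle x y z)"
proof -
  obtain A B C where T: "tangent_triangle x y z = (A, B, C)"
    and d: "dist A B = x + y" "dist B C = y + z" "dist C A = z + x"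
    using tangent_triangle_cases[OF assms(1-3)] .
  have "\<not> collinear {A, B, C}"
    using assms d by (auto simp: collinear_between_cases between dist_commute)
  then show ?thesis
    using assms d by (simp add: T rational_triangle_def)
qed

lemma perimeter_tangent_triangle:
  assumes "x > 0" "y > 0" "z > 0"
  shows "perimeter (tangent_triangle x y z) = 2 * (x + y + z)"
  by (rule tangent_triangle_cases[OF assms]) simp

lemma area_tangent_triangle:
  assumes "x > 0" "y > 0" "z > 0"
  shows "area (tangent_triangle x y z) = sqrt ((x + y + z) * x * y * z)"
proof -
  obtain A B C where T: "tangent_triangle x y z = (A, B, C)"
    and d: "dist A B = x + y" "dist B C = y + z" "dist C A = z + x"
    using tangent_triangle_cases[OF assms] .
  define s where "s = (dist B C + dist A C + dist A B) / 2"
  have s: "s = x + y + z" "s - dist B C = x" "s - dist A C = y" "s - dist A B = z"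
    using d by (simp_all add: s_def dist_commute[of A C] field_simps)
  have "convex hull {A, B, C} \<in> sets borel"
    by (intro borel_closed compact_imp_closed finite_imp_compact_convex_hull) simp
  then have "area (tangent_triangle x y z) = measure lborel (convex hull {A, B, C})"
    by (simp add: T area_def)
  also have "\<dots> = sqrt (s * (s - dist B C) * (s - dist A C) * (s - dist A B))"
    unfolding s_def by (rule heron)
  finally show ?thesis unfolding s(2-4) unfolding s(1) .
qed

text \<open>The law of cosines at the vertex with tangent length \<open>x\<close>. Since
  \<open>cos \<theta> = (1 - \<tau>\<^sup>2)/(1 + \<tau>\<^sup>2)\<close>, the cosine found here says that
  \<open>\<tau>\<^sup>2 = y z / (x (x + y + z))\<close>.\<close>

lemma has_angle_tangent_triangle:
  assumes "x > 0" "y > 0" "z > 0"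
  shows "has_angle (tangent_triangle x y z)
    (arccos ((x * (x + y + z) - y * z) / (x * (x + y + z) + y * z)))"
proof -
  obtain A B C where T: "tangent_triangle x y z = (A, B, C)"
    and d: "dist A B = x + y" "dist B C = y + z" "dist C A = z + x"
    using tangent_triangle_cases[OF assms] .
  have n: "norm (B - A) = x + y" "norm (C - A) = z + x" "norm ((B - A) - (C - A)) = y + z"
    using d by (simp_all add: dist_norm norm_minus_commute)
  have "2 * ((B - A) \<bullet> (C - A)) = (norm (B - A))\<^sup>2 + (norm (C - A))\<^sup>2 - (norm ((B - A) - (C - A)))\<^sup>2"
    unfolding power2_norm_eq_inner
    by (simp add: inner_diff_left inner_diff_right inner_commute)
  then have i: "(B - A) \<bullet> (C - A) = x * (x + y + z) - y * z"
    unfolding n by (simp add: power2_eq_square algebra_simps)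
  have "norm (B - A) * norm (C - A) = x * (x + y + z) + y * z"
    unfolding n by (simp add: algebra_simps)
  then show ?thesis by (simp add: T angle_at_def i)
qed

section \<open>The set of distances as an invariant\<close>

text \<open>The set of side lengths together with 0. Forgetting multiplicities makes the invariance
  under congruence a pure image computation, and the set still tells a scalene
  triangle from an isosceles one by its cardinality.\<close>

definition distance_set :: "triangle \<Rightarrow> real set" where
  "distance_set T = (\<lambda>(u, v). dist u v) ` (vertices T \<times> vertices T)"

lemma distance_set_congruent:
  assumes "congruent_triangles T T'"
  shows "distance_set T = distance_set T'"
proof -
  obtain f where f: "\<And>x y. dist (f x) (f y) = dist x y" "f ` vertices T = vertices T'"
    using assms by (auto simp: congruent_triangles_def)
  have "vertices T' \<times> vertices T' = (\<lambda>(u, v). (f u, f v)) ` (vertices T \<times> vertices T)"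
    unfolding f(2)[symmetric] by auto
  then show ?thesis
    by (simp add: distance_set_def image_image split_def f(1))
qed

lemma distance_set_scale:
  assumes "\<mu> > 0"
  shows "distance_set (scale_triangle \<mu> T) = (\<lambda>d. \<mu> * d) ` distance_set T"
proof -
  have "vertices (scale_triangle \<mu> T) = (\<lambda>v. \<mu> *\<^sub>R v) ` vertices T"
    by (cases T) simp
  then have "vertices (scale_triangle \<mu> T) \<times> vertices (scale_triangle \<mu> T) =
      (\<lambda>(u, v). (\<mu> *\<^sub>R u, \<mu> *\<^sub>R v)) ` (vertices T \<times> vertices T)"
    by auto
  moreover have "dist (\<mu> *\<^sub>R u) (\<mu> *\<^sub>R v) = \<mu> * dist u v" for u v :: "real ^ 2"
    using assms by (simp add: dist_norm flip: scaleR_diff_right)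
  ultimately show ?thesis
    by (simp add: distance_set_def image_image split_def)
qed

lemma distance_set_tangent_triangle:
  assumes "x > 0" "y > 0" "z > 0"
  shows "distance_set (tangent_triangle x y z) = {0, x + y, y + z, z + x}"
proof -
  obtain A B C where T: "tangent_triangle x y z = (A, B, C)"
    and d: "dist A B = x + y" "dist B C = y + z" "dist C A = z + x"
    using tangent_triangle_cases[OF assms] .
  then have "dist B A = x + y" "dist C B = y + z" "dist A C = z + x"
    by (simp_all add: dist_commute)
  with d show ?thesis
    by (auto simp: T distance_set_def)
qed

section \<open>Genuine pairs from solutions of an equation\<close>

text \<open>The parameter is the square root of one tangent length of an isosceles triangle of
  semiperimeter 1, chosen so that the area \<open>\<sigma> (1 - \<sigma>\<^sup>2)/2\<close> is rational for rational \<open>\<sigma>\<close>.\<close>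

definition isosceles_partner :: "real \<Rightarrow> triangle" where
  "isosceles_partner \<sigma> = tangent_triangle ((1 - \<sigma>\<^sup>2) / 2) ((1 - \<sigma>\<^sup>2) / 2) (\<sigma>\<^sup>2)"

text \<open>Rational solutions of the system that makes \<open>tangent_triangle x y z\<close>, with angle
  \<open>2 * arctan \<tau>\<close> at its first vertex, equal in area to \<open>isosceles_partner \<sigma>\<close>. Distinct tangent lengths
  make the first triangle scalene, which rules out congruence.\<close>

definition partner_data :: "real \<Rightarrow> real \<Rightarrow> real \<Rightarrow> real \<Rightarrow> real \<Rightarrow> bool" where
  "partner_data \<tau> \<sigma> x y z \<longleftrightarrow>
     \<sigma> \<in> \<rat> \<and> 0 < \<sigma> \<and> \<sigma> < 1 \<and> x \<in> \<rat> \<and> y \<in> \<rat> \<and> z \<in> \<rat> \<and> 0 < x \<and> 0 < y \<and> 0 < z \<and>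
     x \<noteq> y \<and> y \<noteq> z \<and> z \<noteq> x \<and> x + y + z = 1 \<and> y * z = \<tau>\<^sup>2 * x \<and> \<sigma> * (1 - \<sigma>\<^sup>2) = 2 * \<tau> * x"

lemma distance_set_isosceles_partner:
  assumes "0 < \<sigma>" "\<sigma> < 1"
  shows "distance_set (isosceles_partner \<sigma>) = {0, 1 - \<sigma>\<^sup>2, (1 + \<sigma>\<^sup>2) / 2}"
proof -
  have "\<sigma>\<^sup>2 < 1" using assms by (simp add: power_less_one_iff)
  then have "distance_set (isosceles_partner \<sigma>) =
      {0, (1 - \<sigma>\<^sup>2) / 2 + (1 - \<sigma>\<^sup>2) / 2, (1 - \<sigma>\<^sup>2) / 2 + \<sigma>\<^sup>2, \<sigma>\<^sup>2 + (1 - \<sigma>\<^sup>2) / 2}"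
    unfolding isosceles_partner_def using assms by (intro distance_set_tangent_triangle) auto
  also have "\<dots> = {0, 1 - \<sigma>\<^sup>2, (1 + \<sigma>\<^sup>2) / 2}"
  proof -
    have "(1 - \<sigma>\<^sup>2) / 2 + (1 - \<sigma>\<^sup>2) / 2 = 1 - \<sigma>\<^sup>2"
      "(1 - \<sigma>\<^sup>2) / 2 + \<sigma>\<^sup>2 = (1 + \<sigma>\<^sup>2) / 2" "\<sigma>\<^sup>2 + (1 - \<sigma>\<^sup>2) / 2 = (1 + \<sigma>\<^sup>2) / 2"
      by (simp_all add: field_simps)
    then show ?thesis by (simp only: insert_absorb2)
  qed
  finally show ?thesis .
qed

text \<open>The base and the legs could only be interchanged between the two triangles: then
  \<open>1 - \<sigma>\<^sup>2 = (1 + \<sigma>'\<^sup>2)/2\<close> and \<open>1 - \<sigma>'\<^sup>2 = (1 + \<sigma>\<^sup>2)/2\<close>, and subtracting gives \<open>\<sigma>\<^sup>2 = \<sigma>'\<^sup>2\<close> anyway.\<close>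

lemma isosceles_partner_determines_parameter:
  assumes "0 < \<sigma>" "\<sigma> < 1" "0 < \<sigma>'" "\<sigma>' < 1"
    and "distance_set (isosceles_partner \<sigma>) = distance_set (isosceles_partner \<sigma>')"
  shows "\<sigma> = \<sigma>'"
proof -
  have lt: "\<sigma>\<^sup>2 < 1" "\<sigma>'\<^sup>2 < 1" using assms by (simp_all add: power_less_one_iff)
  have eq: "{0, 1 - \<sigma>\<^sup>2, (1 + \<sigma>\<^sup>2) / 2} = {0, 1 - \<sigma>'\<^sup>2, (1 + \<sigma>'\<^sup>2) / 2}"
    using assms by (simp add: distance_set_isosceles_partner)
  have "1 - \<sigma>\<^sup>2 \<in> {0, 1 - \<sigma>'\<^sup>2, (1 + \<sigma>'\<^sup>2) / 2}"
    unfolding eq[symmetric] by simp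
  then have "1 - \<sigma>\<^sup>2 = 1 - \<sigma>'\<^sup>2 \<or> 1 - \<sigma>\<^sup>2 = (1 + \<sigma>'\<^sup>2) / 2"
    using lt by simp
  moreover have "1 - \<sigma>'\<^sup>2 \<in> {0, 1 - \<sigma>\<^sup>2, (1 + \<sigma>\<^sup>2) / 2}"
    unfolding eq by simp
  then have "1 - \<sigma>'\<^sup>2 = 1 - \<sigma>\<^sup>2 \<or> 1 - \<sigma>'\<^sup>2 = (1 + \<sigma>\<^sup>2) / 2"
    using lt by simp
  ultimately have "\<sigma>\<^sup>2 = \<sigma>'\<^sup>2"
    by (auto simp: field_simps)
  then show ?thesis using assms by simp
qed

text \<open>The areas agree because their squares \<open>x y z = (\<tau> x)\<^sup>2\<close> and \<open>p\<^sup>2 \<sigma>\<^sup>2\<close> do: the cubic equation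
  says \<open>\<sigma> p = \<tau> x\<close> for \<open>p = (1 - \<sigma>\<^sup>2)/2\<close>. Four distances occur in the scalene triangle (counting
  0) and at most three in the isosceles one, so the triangles are not congruent.\<close>

lemma genuine_pair_of_partner_data:
  assumes "partner_data \<tau> \<sigma> x y z"
  shows "genuine_pair ((1 - \<tau>\<^sup>2) / (1 + \<tau>\<^sup>2)) (tangent_triangle x y z, isosceles_partner \<sigma>)"
proof -
  have \<sigma>: "\<sigma> \<in> \<rat>" "0 < \<sigma>" "\<sigma> < 1" and rat: "x \<in> \<rat>" "y \<in> \<rat>" "z \<in> \<rat>"
    and pos: "0 < x" "0 < y" "0 < z" and ne: "x \<noteq> y" "y \<noteq> z" "z \<noteq> x"
    and sum1: "x + y + z = 1" and yz: "y * z = \<tau>\<^sup>2 * x" and cubic: "\<sigma> * (1 - \<sigma>\<^sup>2) = 2 * \<tau> * x"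
    using assms unfolding partner_data_def by blast+
  define p where "p = (1 - \<sigma>\<^sup>2) / 2"
  have p: "p > 0" "\<sigma>\<^sup>2 > 0" "p \<in> \<rat>" "\<sigma>\<^sup>2 \<in> \<rat>"
    using \<sigma> by (simp_all add: p_def power_less_one_iff)
  have I: "isosceles_partner \<sigma> = tangent_triangle p p (\<sigma>\<^sup>2)"
    by (simp add: isosceles_partner_def p_def)
  have ps: "p + p + \<sigma>\<^sup>2 = 1" by (simp add: p_def field_simps)
  have "(x * (x + y + z) - y * z) / (x * (x + y + z) + y * z) = (x * (1 - \<tau>\<^sup>2)) / (x * (1 + \<tau>\<^sup>2))"
    unfolding sum1 yz by (simp only: algebra_simps)
  also have "\<dots> = (1 - \<tau>\<^sup>2) / (1 + \<tau>\<^sup>2)"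
    using pos by simp
  finally have cos: "(x * (x + y + z) - y * z) / (x * (x + y + z) + y * z) = (1 - \<tau>\<^sup>2) / (1 + \<tau>\<^sup>2)" .
  have angle: "has_angle (tangent_triangle x y z) (arccos ((1 - \<tau>\<^sup>2) / (1 + \<tau>\<^sup>2)))"
    using has_angle_tangent_triangle[OF pos] unfolding cos .
  have iso: "isosceles (tangent_triangle p p (\<sigma>\<^sup>2))"
    by (rule tangent_triangle_cases[OF p(1) p(1) p(2)]) (simp add: dist_commute)
  have "\<sigma> * p = \<tau> * x"
    using cubic by (simp add: p_def)
  have "x * y * z = (\<tau> * x)\<^sup>2"
    by (simp add: mult.assoc yz power2_eq_square mult.left_commute)
  also have "\<dots> = (\<sigma> * p)\<^sup>2"
    unfolding \<open>\<sigma> * p = \<tau> * x\<close> ..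
  finally have "(x + y + z) * x * y * z = (p + p + \<sigma>\<^sup>2) * p * p * \<sigma>\<^sup>2"
    unfolding ps sum1 by (simp add: power2_eq_square mult_ac)
  then have area: "area (tangent_triangle x y z) = area (tangent_triangle p p (\<sigma>\<^sup>2))"
    using p pos by (simp only: area_tangent_triangle)
  have "x + y \<noteq> y + z" "y + z \<noteq> z + x" "x + y \<noteq> z + x" "0 < x + y" "0 < y + z" "0 < z + x"
    using ne pos by linarith+
  then have "card {0, x + y, y + z, z + x} = 4"
    by simp
  moreover have "card {0, 1 - \<sigma>\<^sup>2, (1 + \<sigma>\<^sup>2) / 2} \<le> 3"
    by (simp add: card_insert_le_m1)
  ultimately have "{0, x + y, y + z, z + x} \<noteq> {0, 1 - \<sigma>\<^sup>2, (1 + \<sigma>\<^sup>2) / 2}"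
    by force
  then have "distance_set (tangent_triangle x y z) \<noteq> distance_set (isosceles_partner \<sigma>)"
    using pos \<sigma> by (simp only: distance_set_tangent_triangle distance_set_isosceles_partner not_False_eq_True)
  then have "\<not> congruent_triangles (tangent_triangle x y z) (isosceles_partner \<sigma>)"
    using distance_set_congruent by blast
  moreover have "perimeter (tangent_triangle x y z) = perimeter (tangent_triangle p p (\<sigma>\<^sup>2))"
  proof -
    have "perimeter (tangent_triangle x y z) = 2 * (x + y + z)"
      by (rule perimeter_tangent_triangle[OF pos])
    also have "\<dots> = 2 * (p + p + \<sigma>\<^sup>2)" unfolding ps sum1 ..
    also have "\<dots> = perimeter (tangent_triangle p p (\<sigma>\<^sup>2))"
      using p by (intro perimeter_tangent_triangle[symmetric])
    finally show ?thesis .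
  qed
  moreover have "rational_triangle (tangent_triangle x y z)"
    using pos rat by (rule rational_tangent_triangle)
  moreover have "rational_triangle (tangent_triangle p p (\<sigma>\<^sup>2))"
    using p by (intro rational_tangent_triangle)
  ultimately show ?thesis
    unfolding genuine_pair_def split I using angle iso area by blast
qed

text \<open>The distances in a scalene triangle add up to its perimeter, which is 2 for both
  first triangles. So the common scaling factor is 1, the isosceles triangles are
  congruent, and their parameters agree.\<close>

lemma same_pair_imp_eq_parameter:
  assumes "partner_data \<tau> \<sigma> x y z" "partner_data \<tau> \<sigma>' x' y' z'"
    and "same_pair (tangent_triangle x y z, isosceles_partner \<sigma>)
                   (tangent_triangle x' y' z', isosceles_partner \<sigma>')"
  shows "\<sigma> = \<sigma>'"
proof -
  obtain \<mu> where \<mu>: "\<mu> > 0"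
    and T: "distance_set (tangent_triangle x' y' z') = (\<lambda>d. \<mu> * d) ` distance_set (tangent_triangle x y z)"
    and I: "distance_set (isosceles_partner \<sigma>') = (\<lambda>d. \<mu> * d) ` distance_set (isosceles_partner \<sigma>)"
    using assms(3) unfolding same_pair_def
    by (auto dest!: distance_set_congruent simp: distance_set_scale)
  have sum: "\<Sum> (distance_set (tangent_triangle u v w)) = 2" if "partner_data \<tau> s u v w" for s u v w
  proof -
    have "u + v \<noteq> v + w" "v + w \<noteq> w + u" "u + v \<noteq> w + u" "0 < u + v" "0 < v + w" "0 < w + u"
      "u + v + w = 1"
      using that[unfolded partner_data_def] by linarith+
    then show ?thesis
      using that by (simp add: distance_set_tangent_triangle partner_data_def)
  qed
  have "2 = \<Sum> ((\<lambda>d. \<mu> * d) ` distance_set (tangent_triangle x y z))"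
    using sum[OF assms(2)] T by simp
  also have "\<dots> = (\<Sum>d\<in>distance_set (tangent_triangle x y z). \<mu> * d)"
    using \<mu> by (subst sum.reindex) (auto simp: inj_on_def)
  also have "\<dots> = \<mu> * 2"
    using sum[OF assms(1)] by (simp flip: sum_distrib_left)
  finally have "\<mu> = 1" by simp
  with I show ?thesis
    using assms isosceles_partner_determines_parameter[of \<sigma> \<sigma>'] by (auto simp: partner_data_def)
qed

lemma at_least_four_genuine_pairs_if_four_parameters:
  assumes "card S = 4" "\<And>\<sigma>. \<sigma> \<in> S \<Longrightarrow> \<exists>x y z. partner_data \<tau> \<sigma> x y z"
  shows "at_least_four_genuine_pairs ((1 - \<tau>\<^sup>2) / (1 + \<tau>\<^sup>2))"
proof -
  obtain X Y Z where XYZ: "\<And>\<sigma>. \<sigma> \<in> S \<Longrightarrow> partner_data \<tau> \<sigma> (X \<sigma>) (Y \<sigma>) (Z \<sigma>)"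
    using assms(2) by metis
  define F where "F = (\<lambda>\<sigma>. (tangent_triangle (X \<sigma>) (Y \<sigma>) (Z \<sigma>), isosceles_partner \<sigma>))"
  have inj: "inj_on F S"
    by (rule inj_onI) (use XYZ isosceles_partner_determines_parameter in
        \<open>auto simp: F_def partner_data_def\<close>)
  show ?thesis
    unfolding at_least_four_genuine_pairs_def
  proof (intro exI[of _ "F ` S"] conjI ballI)
    show "finite (F ` S)" using assms(1) by (metis card.infinite finite_imageI zero_neq_numeral)
    show "card (F ` S) = 4" using inj assms(1) by (simp add: card_image)
    show "genuine_pair ((1 - \<tau>\<^sup>2) / (1 + \<tau>\<^sup>2)) p" if "p \<in> F ` S" for p
      using that XYZ genuine_pair_of_partner_data by (auto simp: F_def)
    show "pairwise (\<lambda>p q. \<not> same_pair p q) (F ` S)"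
      unfolding pairwise_def F_def using XYZ same_pair_imp_eq_parameter by blast
  qed
qed

section \<open>A family with four solutions\<close>

text \<open>The four solutions are \<open>\<sigma> = a, b\<close> with \<open>x = 1/3\<close> and \<open>\<sigma> = \<tau> \<plusminus> \<delta>\<close> with \<open>x = 4 \<tau>\<^sup>2 - 1\<close>. The
  relation \<open>3 \<tau>\<^sup>2 + \<delta>\<^sup>2 = 1\<close> verifies all equations. The bound \<open>\<tau> > 1/2\<close> amounts to \<open>4 \<tau>\<^sup>2 - 1 > 0\<close>; it
  gives \<open>\<delta> < 1/2 < \<tau>\<close> and \<open>\<tau> + \<delta> < 1\<close>, which puts \<open>\<tau> \<plusminus> \<delta>\<close> between 0 and 1.\<close>

lemma four_genuine_pairs_family:
  fixes a b :: real
  assumes rat: "a \<in> \<rat>" "b \<in> \<rat>" and ab: "0 < b" "b < a" and norm1: "a\<^sup>2 + a * b + b\<^sup>2 = 1"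
    and \<tau>_def: "\<tau> = 3 / 2 * (a * b * (a + b))" and \<tau>: "\<tau> > 1 / 2"
  shows "at_least_four_genuine_pairs ((1 - \<tau>\<^sup>2) / (1 + \<tau>\<^sup>2))"
proof -
  define \<delta> where "\<delta> = (a - b) * (2 * a + b) * (a + 2 * b) / 2"
  have \<delta>0: "\<delta> > 0" using ab by (simp add: \<delta>_def)
  have rat': "\<tau> \<in> \<rat>" "\<delta> \<in> \<rat>" using rat by (simp_all add: \<tau>_def \<delta>_def)
  \<comment> \<open>this is the discriminant identity of the cubic with roots \<open>a\<close>, \<open>b\<close>, \<open>- (a + b)\<close>\<close>
  have "3 * \<tau>\<^sup>2 + \<delta>\<^sup>2 = (a\<^sup>2 + a * b + b\<^sup>2) ^ 3"
    by (simp add: \<tau>_def \<delta>_def power2_eq_square power3_eq_cube field_simps)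
  then have \<delta>2: "\<delta>\<^sup>2 = 1 - 3 * \<tau>\<^sup>2" by (simp add: norm1)
  have \<tau>2: "\<tau>\<^sup>2 > 1 / 4"
    using power_strict_mono[OF \<tau>, of 2] by (simp add: power_divide)
  have "\<delta>\<^sup>2 > 0" using \<delta>0 by simp
  then have \<tau>3: "\<tau>\<^sup>2 < 1 / 3" using \<delta>2 by simp
  have "\<delta>\<^sup>2 < (1 / 2)\<^sup>2" using \<delta>2 \<tau>2 by (simp add: power_divide)
  then have \<delta>half: "\<delta> < 1 / 2" by (rule power_less_imp_less_base) simp
  have "\<delta>\<^sup>2 < (1 - \<tau>)\<^sup>2"
  proof -
    have "0 < 2 * \<tau> * (2 * \<tau> - 1)" using \<tau> by simp
    also have "\<dots> = (1 - \<tau>)\<^sup>2 - \<delta>\<^sup>2"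
      unfolding \<delta>2 by (simp add: power2_eq_square algebra_simps)
    finally show ?thesis by simp
  qed
  moreover have "\<tau> < 1"
    by (rule power_less_imp_less_base[of _ 2]) (use \<tau>3 in auto)
  ultimately have \<tau>\<delta>: "\<tau> + \<delta> < 1"
    using power_less_imp_less_base[of \<delta> 2 "1 - \<tau>"] by simp
  have a1: "a < 1" and b1: "b < 1"
  proof -
    have "a\<^sup>2 < 1" using norm1 ab by (smt (verit) mult_pos_pos zero_le_power2)
    then show "a < 1" using ab by (simp add: power_less_one_iff)
    then show "b < 1" using ab by simp
  qed
  have x1: "partner_data \<tau> \<sigma> (1 / 3) ((1 + \<delta>) / 3) ((1 - \<delta>) / 3)" if "\<sigma> = a \<or> \<sigma> = b" for \<sigma>
  proof -
    have "a * (1 - a\<^sup>2) = 2 * \<tau> / 3" "b * (1 - b\<^sup>2) = 2 * \<tau> / 3"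
      unfolding norm1[symmetric] \<tau>_def by (simp_all add: power2_eq_square algebra_simps)
    then have "\<sigma> * (1 - \<sigma>\<^sup>2) = 2 * \<tau> * (1 / 3)" using that by auto
    moreover have "(1 + \<delta>) / 3 * ((1 - \<delta>) / 3) = \<tau>\<^sup>2 * (1 / 3)"
    proof -
      have "(1 + \<delta>) / 3 * ((1 - \<delta>) / 3) = (1 - \<delta>\<^sup>2) / 9"
        by (simp add: power2_eq_square field_simps)
      then show ?thesis by (simp add: \<delta>2)
    qed
    moreover have "\<sigma> \<in> \<rat>" "0 < \<sigma>" "\<sigma> < 1" using that rat ab a1 b1 by auto
    moreover have "1 / 3 \<in> (\<rat> :: real set)" "(1 + \<delta>) / 3 \<in> \<rat>" "(1 - \<delta>) / 3 \<in> \<rat>"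
      using rat' by simp_all
    moreover have "0 < (1 / 3 :: real)" "0 < (1 + \<delta>) / 3" "0 < (1 - \<delta>) / 3" "1 / 3 \<noteq> (1 + \<delta>) / 3"
      "(1 + \<delta>) / 3 \<noteq> (1 - \<delta>) / 3" "(1 - \<delta>) / 3 \<noteq> 1 / 3"
      "1 / 3 + (1 + \<delta>) / 3 + (1 - \<delta>) / 3 = 1"
      using \<delta>0 \<delta>half by (simp_all add: add_divide_distrib diff_divide_distrib)
    ultimately show ?thesis
      unfolding partner_data_def by blast
  qed
  have x2: "partner_data \<tau> \<sigma> (4 * \<tau>\<^sup>2 - 1) (1 - 2 * \<tau>\<^sup>2 + \<delta>) (1 - 2 * \<tau>\<^sup>2 - \<delta>)"
    if "\<sigma> = \<tau> - \<delta> \<or> \<sigma> = \<tau> + \<delta>" for \<sigma>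
  proof -
    have "1 - (\<tau> - \<delta>)\<^sup>2 = 2 * \<tau> * (\<tau> + \<delta>)" "1 - (\<tau> + \<delta>)\<^sup>2 = 2 * \<tau> * (\<tau> - \<delta>)"
      unfolding power2_diff power2_sum \<delta>2 by (simp_all add: power2_eq_square algebra_simps)
    then have "(\<tau> - \<delta>) * (1 - (\<tau> - \<delta>)\<^sup>2) = 2 * \<tau> * (\<tau>\<^sup>2 - \<delta>\<^sup>2)"
      "(\<tau> + \<delta>) * (1 - (\<tau> + \<delta>)\<^sup>2) = 2 * \<tau> * (\<tau>\<^sup>2 - \<delta>\<^sup>2)"
      by (simp_all only: power2_eq_square square_diff_square_factored mult_ac)
    moreover have "\<tau>\<^sup>2 - \<delta>\<^sup>2 = 4 * \<tau>\<^sup>2 - 1"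
      by (simp add: \<delta>2)
    ultimately have cubic: "\<sigma> * (1 - \<sigma>\<^sup>2) = 2 * \<tau> * (4 * \<tau>\<^sup>2 - 1)"
      using that by metis
    have "(1 - 2 * \<tau>\<^sup>2 + \<delta>) * (1 - 2 * \<tau>\<^sup>2 - \<delta>) = (1 - 2 * \<tau>\<^sup>2)\<^sup>2 - \<delta>\<^sup>2"
      by (simp add: power2_eq_square algebra_simps)
    also have "\<dots> = \<tau>\<^sup>2 * (4 * \<tau>\<^sup>2 - 1)"
      unfolding \<delta>2 by (simp add: power2_eq_square algebra_simps)
    finally have yz: "(1 - 2 * \<tau>\<^sup>2 + \<delta>) * (1 - 2 * \<tau>\<^sup>2 - \<delta>) = \<tau>\<^sup>2 * (4 * \<tau>\<^sup>2 - 1)" .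
    have "(1 - 2 * \<tau>\<^sup>2 + \<delta>) * (1 - 2 * \<tau>\<^sup>2 - \<delta>) > 0"
      unfolding yz using \<tau> \<tau>2 by simp
    moreover have y: "1 - 2 * \<tau>\<^sup>2 + \<delta> > 0"
      using \<delta>0 \<tau>3 by simp
    ultimately have z: "1 - 2 * \<tau>\<^sup>2 - \<delta> > 0"
      by (rule zero_less_mult_pos)
    \<comment> \<open>\<open>6 \<tau>\<^sup>2 - 2 = - 2 \<delta>\<^sup>2\<close>, so a coincidence with \<open>4 \<tau>\<^sup>2 - 1\<close> would mean \<open>2 \<delta>\<^sup>2 = \<plusminus> \<delta>\<close>\<close>
    have "2 * \<delta> * \<delta> < \<delta>" using \<delta>0 \<delta>half by simp
    then have "2 * \<delta>\<^sup>2 < \<delta>" by (simp add: power2_eq_square)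
    then have ne: "4 * \<tau>\<^sup>2 - 1 \<noteq> 1 - 2 * \<tau>\<^sup>2 + \<delta>" "4 * \<tau>\<^sup>2 - 1 \<noteq> 1 - 2 * \<tau>\<^sup>2 - \<delta>"
      using \<delta>2 \<delta>0 \<tau>3 by linarith+
    have "\<sigma> \<in> \<rat>" "0 < \<sigma>" "\<sigma> < 1" using that rat' \<delta>0 \<delta>half \<tau> \<tau>\<delta> by auto
    moreover have "4 * \<tau>\<^sup>2 - 1 \<in> \<rat>" "1 - 2 * \<tau>\<^sup>2 + \<delta> \<in> \<rat>" "1 - 2 * \<tau>\<^sup>2 - \<delta> \<in> \<rat>"
      using rat' by simp_all
    moreover have "0 < 4 * \<tau>\<^sup>2 - 1" "1 - 2 * \<tau>\<^sup>2 + \<delta> \<noteq> 1 - 2 * \<tau>\<^sup>2 - \<delta>"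
      "4 * \<tau>\<^sup>2 - 1 + (1 - 2 * \<tau>\<^sup>2 + \<delta>) + (1 - 2 * \<tau>\<^sup>2 - \<delta>) = 1"
      using \<delta>0 \<tau>2 by simp_all
    ultimately show ?thesis
      unfolding partner_data_def using y z ne(1) ne(2)[symmetric] yz cubic by blast
  qed
  have "a \<noteq> \<sigma>'" "b \<noteq> \<sigma>'" if "\<sigma>' = \<tau> - \<delta> \<or> \<sigma>' = \<tau> + \<delta>" for \<sigma>'
  proof -
    \<comment> \<open>the two triangles have different areas, so no isosceles triangle serves both\<close>
    have "2 * \<tau> * (1 / 3) \<noteq> 2 * \<tau> * (4 * \<tau>\<^sup>2 - 1)" using \<tau> \<tau>3 by simp
    then show "a \<noteq> \<sigma>'" "b \<noteq> \<sigma>'"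
      using x1[of a] x1[of b] x2[OF that] unfolding partner_data_def by metis+
  qed
  then have "a \<noteq> \<tau> - \<delta>" "a \<noteq> \<tau> + \<delta>" "b \<noteq> \<tau> - \<delta>" "b \<noteq> \<tau> + \<delta>"
    by blast+
  moreover have "a \<noteq> b" "\<tau> - \<delta> \<noteq> \<tau> + \<delta>" using ab \<delta>0 by simp_all
  ultimately have "card {a, b, \<tau> - \<delta>, \<tau> + \<delta>} = 4"
    by simp
  then show ?thesis
    by (rule at_least_four_genuine_pairs_if_four_parameters) (use x1 x2 in blast)
qed

section \<open>Density\<close>

text \<open>The value of \<open>\<tau>\<close> in the family above at the point
  \<open>a = (2 m + 1)/(m\<^sup>2 + m + 1)\<close>, \<open>b = (m\<^sup>2 - 1)/(m\<^sup>2 + m + 1)\<close> of the conic \<open>a\<^sup>2 + a b + b\<^sup>2 = 1\<close>.\<close>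

definition family_tan :: "real \<Rightarrow> real" where
  "family_tan m = 3 / 2 * ((2 * m + 1) * (m\<^sup>2 - 1) * (m\<^sup>2 + 2 * m) / (m\<^sup>2 + m + 1) ^ 3)"

definition family_cos :: "real \<Rightarrow> real" where
  "family_cos m = (1 - (family_tan m)\<^sup>2) / (1 + (family_tan m)\<^sup>2)"

text \<open>For \<open>m < 5/2\<close> one has \<open>m\<^sup>2 - 2 m - 2 < 0\<close>, hence \<open>b < a\<close>; and \<open>cos \<theta> < 3/5\<close> is the same as
  \<open>tan (\<theta>/2) > 1/2\<close>.\<close>

lemma four_genuine_pairs_family_cos:
  assumes "m \<in> \<rat>" "2 < m" "m < 5 / 2" "family_cos m < 3 / 5"
  shows "family_cos m \<in> \<rat>" "at_least_four_genuine_pairs (family_cos m)"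
proof -
  define N a b where "N = m\<^sup>2 + m + 1" and "a = (2 * m + 1) / N" and "b = (m\<^sup>2 - 1) / N"
  have N: "N > 0" using assms by (simp add: N_def add_pos_pos)
  have m2: "m\<^sup>2 > 2\<^sup>2" using assms by (intro power_strict_mono) auto
  have "m\<^sup>2 - 2 * m - 2 < 0"
  proof -
    have "m * (m - 2) < 5 / 2 * (1 / 2)" using assms by (intro mult_strict_mono) auto
    then show ?thesis by (simp add: power2_eq_square algebra_simps)
  qed
  then have ab: "0 < b" "b < a" using N m2 by (simp_all add: a_def b_def divide_strict_right_mono)
  have rat: "a \<in> \<rat>" "b \<in> \<rat>" using assms by (simp_all add: a_def b_def N_def)
  have "a\<^sup>2 + a * b + b\<^sup>2 = ((2 * m + 1)\<^sup>2 + (2 * m + 1) * (m\<^sup>2 - 1) + (m\<^sup>2 - 1)\<^sup>2) / N\<^sup>2"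
    by (simp add: a_def b_def power_divide power2_eq_square[of N] flip: add_divide_distrib)
  also have "(2 * m + 1)\<^sup>2 + (2 * m + 1) * (m\<^sup>2 - 1) + (m\<^sup>2 - 1)\<^sup>2 = N\<^sup>2"
    by (simp add: N_def power2_eq_square algebra_simps)
  finally have norm1: "a\<^sup>2 + a * b + b\<^sup>2 = 1" using N by simp
  have apb: "a + b = (m\<^sup>2 + 2 * m) / N" by (simp add: a_def b_def flip: add_divide_distrib)
  have \<tau>: "family_tan m = 3 / 2 * (a * b * (a + b))"
    unfolding apb by (simp add: family_tan_def a_def b_def power3_eq_cube flip: N_def)
  have "1 + (family_tan m)\<^sup>2 > 0" by (simp add: add_pos_nonneg)
  then have "(1 / 2)\<^sup>2 < (family_tan m)\<^sup>2"
    using assms(4) by (simp add: family_cos_def field_simps)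
  moreover have "family_tan m \<ge> 0" using ab by (simp add: \<tau>)
  ultimately have "1 / 2 < family_tan m" by (rule power_less_imp_less_base)
  then show "at_least_four_genuine_pairs (family_cos m)"
    unfolding family_cos_def by (intro four_genuine_pairs_family[OF rat ab norm1 \<tau>])
  have "family_tan m \<in> \<rat>" using rat by (simp add: \<tau>)
  then show "family_cos m \<in> \<rat>" by (simp add: family_cos_def)
qed

lemma family_cos_2: "family_cos 2 = 85249 / 150049"
  by (simp add: family_cos_def family_tan_def power_divide)

lemma family_cos_5_2: "family_cos (5 / 2) = 3239209 / 6414409"
  by (simp add: family_cos_def family_tan_def power_divide)

lemma continuous_on_family_cos: "continuous_on {2..5/2} family_cos"
proof -
  have "1 + (family_tan m)\<^sup>2 \<noteq> 0" for m
    by (metis add_pos_nonneg less_numeral_extra(1,3) zero_le_power2)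
  moreover have "(m\<^sup>2 + m + 1) ^ 3 \<noteq> 0" if "m \<in> {2..5/2}" for m :: real
    using that by (smt (verit) atLeastAtMost_iff zero_le_power2 power_not_zero)
  then have "continuous_on {2..5/2} family_tan"
    unfolding family_tan_def by (intro continuous_intros) auto
  ultimately show ?thesis
    unfolding family_cos_def by (intro continuous_intros) auto
qed

theorem corollary9p2:
  shows "{3239209 / 6414409 .. 85249 / 150049 :: real} \<subseteq>
    closure ({\<rho> \<in> \<rat>. -1 < \<rho> \<and> \<rho> < 1 \<and> at_least_four_genuine_pairs \<rho>} \<inter>
             {3239209 / 6414409 .. 85249 / 150049})"
    (is "?I \<subseteq> closure ?G")
proof -
  define J where "J = {3239209 / 6414409 <..< 85249 / 150049 :: real}"
  \<comment> \<open>monotonicity of \<open>family_cos\<close> is avoided by restricting to parameters whose value lies in \<open>J\<close>\<close>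
  define U where "U = {2<..<5/2} \<inter> family_cos -` J"
  have "continuous_on {2<..<5/2} family_cos"
    using continuous_on_family_cos by (rule continuous_on_subset) auto
  then have "open U"
    unfolding U_def J_def by (intro continuous_open_preimage) auto
  then have "U \<subseteq> closure (U \<inter> \<rat>)"
    using open_Int_closure_subset[of U \<rat>] by (simp add: Rats_closure_real)
  have in_G: "family_cos m \<in> ?G" if "m \<in> U \<inter> \<rat>" for m
    using that four_genuine_pairs_family_cos[of m] by (auto simp: U_def J_def)
  have "J \<subseteq> closure ?G"
  proof
    fix \<rho> assume \<rho>: "\<rho> \<in> J"
    then have "\<exists>m\<ge>2. m \<le> 5 / 2 \<and> family_cos m = \<rho>"
      by (intro IVT2' continuous_on_family_cos) (auto simp: J_def family_cos_2 family_cos_5_2)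
    then obtain m where m: "2 \<le> m" "m \<le> 5 / 2" "family_cos m = \<rho>" by auto
    with \<rho> have "m \<noteq> 2" "m \<noteq> 5 / 2"
      using family_cos_2 family_cos_5_2 unfolding J_def
      by (metis greaterThanLessThan_iff less_irrefl)+
    with m \<rho> have mU: "m \<in> U" by (simp add: U_def)
    have "isCont family_cos m"
      using continuous_on_interior[OF continuous_on_family_cos] mU by (simp add: U_def)
    moreover obtain s where s: "\<And>n. s n \<in> U \<inter> \<rat>" "s \<longlonglongrightarrow> m"
      using \<open>U \<subseteq> closure (U \<inter> \<rat>)\<close> mU by (metis closure_sequential subsetD)
    ultimately have "(\<lambda>n. family_cos (s n)) \<longlonglongrightarrow> \<rho>"
      using m isCont_tendsto_compose by blast
    moreover have "family_cos (s n) \<in> ?G" for n using in_G s by blast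
    ultimately show "\<rho> \<in> closure ?G"
      unfolding closure_sequential
      by (intro exI[of _ "\<lambda>n. family_cos (s n)"] conjI allI)
  qed
  then have "closure J \<subseteq> closure ?G" by (simp add: closure_minimal)
  then show ?thesis by (simp add: J_def)
qed

end
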